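(* Let $G$ be a compactly generated locally compact group. Then the $FC^-$-class of $G$ is at most $\omega_0$. If $G$ is $FC^-$-hypercentral, then the $FC^-$-class of $G$ is finite.
   Context: Locally compact groups are Hausdorff. For a locally compact group $L$, $B(L)$ denotes the subgroup of elements of $L$ with relatively compact conjugacy class. The (topological) upper $FC^-$-central series of $G$ is defined by $B_0(G)=\{e\}$, $B_1(G)=\overline{B(G)}$, $B_{\alpha+1}(G)/B_\alpha(G)=\overline{B(G/B_\alpha(G))}$ for ordinals $\alpha$, and $B_\lambda(G)=\overline{\bigcup_{\alpha<\lambda}B_\alpha(G)}$ for limit ordinals $\lambda$. The least ordinal $\alpha$ such that $B_{\alpha+1}(G)=B_\alpha(G)$ is called the $FC^-$-class of $G$, and for this $\alpha$, $\zeta_{FC^-}(G)=B_\alpha(G)$ is the $FC^-$-hypercentre. $G$ is $FC^-$-hypercentral if $\zeta_{FC^-}(G)=G$. $\omega_0$ denotes the smallest infinite ordinal. *)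

theory Defs
  imports "HOL-Analysis.Analysis" "HOL-Algebra.Generated_Groups"
begin

section \<open>Locally compact groups\<close>

locale topological_group = group G for G (structure) and T +
  assumes topspace_carrier: "topspace T = carrier G"
    and continuous_mult: "continuous_map (prod_topology T T) T (\<lambda>(x, y). x \<otimes> y)"
    and continuous_inv: "continuous_map T T (\<lambda>x. inv x)"

locale locally_compact_group = topological_group +
  assumes Hausdorff: "Hausdorff_space T"
    and locally_compact: "locally_compact_space T"

definition compactly_generated :: "('a, 'b) monoid_scheme \<Rightarrow> 'a topology \<Rightarrow> bool" where
  "compactly_generated G T \<longleftrightarrow> (\<exists>K. compactin T K \<and> generate G K = carrier G)"

definition conjugates :: "('a, 'b) monoid_scheme \<Rightarrow> 'a \<Rightarrow> 'a set" where
  "conjugates G x = {g \<otimes>\<^bsub>G\<^esub> x \<otimes>\<^bsub>G\<^esub> inv\<^bsub>G\<^esub> g | g. g \<in> carrier G}"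

text \<open>The subgroup $B(G)$.\<close>

definition FC_elements :: "('a, 'b) monoid_scheme \<Rightarrow> 'a topology \<Rightarrow> 'a set" where
  "FC_elements G T = {x \<in> carrier G. compactin T (T closure_of conjugates G x)}"

section \<open>Quotient groups\<close>

definition quotient_topology :: "'a topology \<Rightarrow> ('a \<Rightarrow> 'b) \<Rightarrow> 'b topology" where
  "quotient_topology X q =
     topology (\<lambda>U. U \<subseteq> q ` topspace X \<and> openin X {x \<in> topspace X. q x \<in> U})"

lemma openin_quotient_topology:
  "openin (quotient_topology X q) U \<longleftrightarrow>
     U \<subseteq> q ` topspace X \<and> openin X {x \<in> topspace X. q x \<in> U}"
proof -
  let ?P = "\<lambda>U. U \<subseteq> q ` topspace X \<and> openin X {x \<in> topspace X. q x \<in> U}"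
  have "istopology ?P"
    unfolding istopology_def
  proof (intro conjI allI impI)
    fix S U assume S: "?P S" and U: "?P U"
    have "{x \<in> topspace X. q x \<in> S \<inter> U} =
        {x \<in> topspace X. q x \<in> S} \<inter> {x \<in> topspace X. q x \<in> U}" by auto
    then show "openin X {x \<in> topspace X. q x \<in> S \<inter> U}" using S U by auto
    show "S \<inter> U \<subseteq> q ` topspace X" using S by auto
  next
    fix \<K> assume K: "\<forall>U\<in>\<K>. ?P U"
    have "{x \<in> topspace X. q x \<in> \<Union>\<K>} = (\<Union>U\<in>\<K>. {x \<in> topspace X. q x \<in> U})" by auto
    then show "openin X {x \<in> topspace X. q x \<in> \<Union>\<K>}" using K by auto
    show "\<Union>\<K> \<subseteq> q ` topspace X" using K by auto
  qed
  then show ?thesis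
    unfolding quotient_topology_def by (simp add: topology_inverse')
qed

lemma topspace_quotient_topology [simp]: "topspace (quotient_topology X q) = q ` topspace X"
proof
  show "topspace (quotient_topology X q) \<subseteq> q ` topspace X"
    by (metis openin_topspace openin_quotient_topology)
  have "{x \<in> topspace X. q x \<in> q ` topspace X} = topspace X" by auto
  then have "openin (quotient_topology X q) (q ` topspace X)"
    by (simp add: openin_quotient_topology)
  then show "q ` topspace X \<subseteq> topspace (quotient_topology X q)"
    by (rule openin_subset)
qed

lemma quotient_map_quotient_topology: "quotient_map X (quotient_topology X q) q"
  by (auto simp: quotient_map_def openin_quotient_topology)

text \<open>The topology of \<^term>\<open>G Mod N\<close>, whose elements are right cosets.\<close>

definition coset_topology :: "('a, 'b) monoid_scheme \<Rightarrow> 'a topology \<Rightarrow> 'a set \<Rightarrow> 'a set topology" where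
  "coset_topology G T N = quotient_topology T (\<lambda>x. N #>\<^bsub>G\<^esub> x)"

text \<open>The preimage in $G$ of the closure of $B(G/N)$.\<close>

definition FC_step :: "('a, 'b) monoid_scheme \<Rightarrow> 'a topology \<Rightarrow> 'a set \<Rightarrow> 'a set" where
  "FC_step G T N = {x \<in> carrier G. N #>\<^bsub>G\<^esub> x \<in>
     coset_topology G T N closure_of FC_elements (G Mod N) (coset_topology G T N)}"

section \<open>Ordinals\<close>

text \<open>
  The library type \<^typ>\<open>'k suc\<close> is the underlying set of the successor cardinal of the
  cardinality of \<^typ>\<open>'k\<close>. With its well-order, its elements are the ordinals
  $\alpha$ with $|\alpha| \le |\mathit{k}|$.
\<close>

unbundle cardinal_syntax

instantiation suc :: (type) wellorder
begin

definition less_eq_suc :: "'a suc \<Rightarrow> 'a suc \<Rightarrow> bool" where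
  "less_eq_suc x y \<longleftrightarrow> (x, y) \<in> card_suc |UNIV :: 'a set|"

definition less_suc :: "'a suc \<Rightarrow> 'a suc \<Rightarrow> bool" where
  "less_suc x y \<longleftrightarrow> x \<le> y \<and> \<not> y \<le> (x :: 'a suc)"

instance
proof -
  let ?r = "card_suc |UNIV :: 'a set|"
  have F: "Field ?r = UNIV" by (rule Field_card_suc)
  have "card_order ?r" by (rule card_order_card_suc) (rule card_of_card_order_on)
  then have wo: "well_order ?r" by (rule card_order_on_well_order_on)
  then have lin: "refl ?r" "trans ?r" "antisym ?r" "total ?r" and wf: "wf (?r - Id)"
    by (auto simp: well_order_on_def linear_order_on_def partial_order_on_def preorder_on_def
        intro: refl_onI)
  show "OFCLASS('a suc, wellorder_class)"
  proof
    fix x y z :: "'a suc"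
    show "x < y \<longleftrightarrow> x \<le> y \<and> \<not> y \<le> x" by (rule less_suc_def)
    show "x \<le> x" unfolding less_eq_suc_def using lin(1) by (simp add: refl_on_def)
    show "x \<le> y \<Longrightarrow> y \<le> z \<Longrightarrow> x \<le> z"
      unfolding less_eq_suc_def using lin(2) by (rule transD)
    show "x \<le> y \<Longrightarrow> y \<le> x \<Longrightarrow> x = y"
      unfolding less_eq_suc_def using lin(3) by (rule antisymD)
    show "x \<le> y \<or> y \<le> x"
      unfolding less_eq_suc_def using lin(1,4) by (metis refl_on_def total_on_def UNIV_I)
  next
    fix P :: "'a suc \<Rightarrow> bool" and a :: "'a suc"
    assume step: "\<And>x. (\<And>y. y < x \<Longrightarrow> P y) \<Longrightarrow> P x"
    show "P a"
      using wf
    proof (induction a rule: wf_induct_rule)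
      case (less x)
      show ?case
      proof (rule step)
        fix y assume "y < x"
        then have "(y, x) \<in> ?r - Id" unfolding less_suc_def less_eq_suc_def by auto
        then show "P y" by (rule less.IH)
      qed
    qed
  qed
qed

end

text \<open>
  Ordinals large enough to measure a transfinite series of subsets of \<^typ>\<open>'a\<close>: a strictly
  increasing one has length of cardinality at most that of \<^typ>\<open>'a\<close>. The summand
  \<^typ>\<open>nat\<close> makes $\omega_0$ available, and closure under successors, when \<^typ>\<open>'a\<close> is finite.
\<close>

type_synonym 'a ordinal = "('a + nat) suc"

definition ordsucc :: "'i::wellorder \<Rightarrow> 'i" where
  "ordsucc \<alpha> = (LEAST \<beta>. \<alpha> < \<beta>)"

definition finite_ordinal :: "'i::wellorder \<Rightarrow> bool" where
  "finite_ordinal \<alpha> \<longleftrightarrow> finite {..<\<alpha>}"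

definition omega0 :: "'i::wellorder" where
  "omega0 = (LEAST \<alpha>. \<not> finite_ordinal \<alpha>)"

lemma infinite_UNIV_ordinal: "infinite (UNIV :: 'a ordinal set)"
proof
  assume "finite (UNIV :: 'a ordinal set)"
  let ?r = "card_suc |UNIV :: ('a + nat) set|"
  have co: "card_order |UNIV :: ('a + nat) set|" by (rule card_of_card_order_on)
  have "|UNIV :: ('a + nat) set| <o ?r" using co by (rule card_suc_greater)
  moreover have "?r =o |UNIV :: 'a ordinal set|"
    using card_of_Field_ordIso[OF Card_order_card_suc[OF co]]
    by (simp add: Field_card_suc ordIso_symmetric)
  ultimately have "|UNIV :: ('a + nat) set| <o |UNIV :: 'a ordinal set|"
    by (rule ordLess_ordIso_trans)
  then have "finite (UNIV :: ('a + nat) set)"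
    using \<open>finite (UNIV :: 'a ordinal set)\<close> card_of_ordLeq_finite ordLess_imp_ordLeq by blast
  then show False by simp
qed

lemma ordinal_no_max: "\<exists>\<beta>. (\<alpha> :: 'a ordinal) < \<beta>"
proof -
  let ?r = "card_suc |UNIV :: ('a + nat) set|"
  have "Card_order ?r" by (rule Card_order_card_suc) (rule card_of_card_order_on)
  then have "\<exists>\<beta>\<in>Field ?r. \<alpha> \<noteq> \<beta> \<and> (\<alpha>, \<beta>) \<in> ?r"
    by (rule infinite_Card_order_limit) (simp_all add: Field_card_suc infinite_UNIV_ordinal)
  then obtain \<beta> where "\<alpha> \<noteq> \<beta>" "\<alpha> \<le> \<beta>" unfolding less_eq_suc_def by auto
  then show ?thesis by (intro exI[of _ \<beta>]) simp
qed

lemma less_ordsucc: "(\<alpha> :: 'a ordinal) < ordsucc \<alpha>"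
  unfolding ordsucc_def by (rule LeastI_ex) (rule ordinal_no_max)

lemma lessThan_ordsucc: "{..<ordsucc \<alpha>} = {..\<alpha> :: 'a ordinal}"
proof (intro equalityI subsetI)
  fix \<beta> assume "\<beta> \<in> {..<ordsucc \<alpha>}"
  then have "\<not> \<alpha> < \<beta>" unfolding ordsucc_def by (auto dest: not_less_Least)
  then show "\<beta> \<in> {..\<alpha>}" by simp
qed (use less_ordsucc[of \<alpha>] in auto)

lemma infinite_ordinal_exists: "\<exists>\<alpha> :: 'a ordinal. \<not> finite_ordinal \<alpha>"
proof (rule ccontr)
  assume "\<not> ?thesis"
  then have fin: "finite {..<\<alpha>}" for \<alpha> :: "'a ordinal" by (simp add: finite_ordinal_def)
  let ?r = "card_suc |UNIV :: ('a + nat) set|"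
  have co: "card_order |UNIV :: ('a + nat) set|" by (rule card_of_card_order_on)
  have "inj (\<lambda>\<alpha> :: 'a ordinal. card {..<\<alpha>})"
  proof (rule linorder_injI)
    fix \<alpha> \<beta> :: "'a ordinal" assume "\<alpha> < \<beta>"
    then have "{..<\<alpha>} \<subset> {..<\<beta>}" by auto
    then have "card {..<\<alpha>} < card {..<\<beta>}" by (rule psubset_card_mono[OF fin])
    then show "card {..<\<alpha>} \<noteq> card {..<\<beta>}" by simp
  qed
  then have "inj (\<lambda>\<alpha> :: 'a ordinal. Inr (card {..<\<alpha>}) :: 'a + nat)"
    by (simp add: inj_on_def)
  then have "|UNIV :: 'a ordinal set| \<le>o |UNIV :: ('a + nat) set|"
    using card_of_ordLeq[of "UNIV :: 'a ordinal set" "UNIV :: ('a + nat) set"] by blast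
  moreover have "|UNIV :: ('a + nat) set| <o ?r" using co by (rule card_suc_greater)
  moreover have "?r =o |UNIV :: 'a ordinal set|"
    using card_of_Field_ordIso[OF Card_order_card_suc[OF co]]
    by (simp add: Field_card_suc ordIso_symmetric)
  ultimately show False
    using not_ordLess_ordLeq ordLess_ordIso_trans by blast
qed

unbundle no cardinal_syntax

section \<open>The upper $FC^-$-central series\<close>

text \<open>
  The three branches are $\alpha = 0$, $\alpha = \beta + 1$, and $\alpha$ a limit.
\<close>

function FC_series ::
  "('a, 'b) monoid_scheme \<Rightarrow> 'a topology \<Rightarrow> 'i::wellorder \<Rightarrow> 'a set" where
  "FC_series G T \<alpha> =
     (if {..<\<alpha>} = {} then {\<one>\<^bsub>G\<^esub>}
      else if \<exists>\<beta>. {..<\<alpha>} = {..\<beta>}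
        then FC_step G T (FC_series G T (THE \<beta>. {..<\<alpha>} = {..\<beta>}))
      else T closure_of (\<Union>\<beta>\<in>{..<\<alpha>}. FC_series G T \<beta>))"
  by pat_completeness auto
termination
proof (relation "inv_image {(x, y). x < y} (\<lambda>(G, T, \<alpha>). \<alpha>)", goal_cases)
  case 1
  show ?case by (rule wf_inv_image) (rule wf)
next
  case (2 G T \<alpha>)
  then obtain \<beta> where \<beta>: "{..<\<alpha>} = {..\<beta>}" by blast
  then have "(THE \<beta>. {..<\<alpha>} = {..\<beta>}) = \<beta>" by (auto intro!: the_equality)
  moreover have "\<beta> < \<alpha>" using \<beta> by auto
  ultimately show ?case by simp
next
  case (3 G T \<alpha> \<beta>)
  then show ?case by simp
qed

declare FC_series.simps [simp del]

lemma FC_series_zero: "{..<\<alpha>} = {} \<Longrightarrow> FC_series G T \<alpha> = {\<one>\<^bsub>G\<^esub>}"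
  by (simp add: FC_series.simps[of G T \<alpha>])

lemma FC_series_ordsucc:
  "FC_series G T (ordsucc \<alpha>) = FC_step G T (FC_series G T (\<alpha> :: 'a ordinal))"
proof -
  have eq: "(THE \<beta>. {..\<alpha>} = {..\<beta>}) = \<alpha>" by (auto intro!: the_equality)
  show ?thesis
    by (subst FC_series.simps) (auto simp: lessThan_ordsucc eq)
qed

lemma FC_series_limit:
  assumes "{..<\<alpha>} \<noteq> {}" "\<And>\<beta>. \<beta> < \<alpha> \<Longrightarrow> \<exists>\<gamma><\<alpha>. \<beta> < \<gamma>"
  shows "FC_series G T \<alpha> = T closure_of (\<Union>\<beta>\<in>{..<\<alpha>}. FC_series G T \<beta>)"
proof -
  have "{..<\<alpha>} \<noteq> {..\<beta>}" for \<beta>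
    using assms(2)[of \<beta>] by (metis atMost_iff lessThan_iff not_less order_refl)
  then show ?thesis using assms(1) by (subst FC_series.simps) simp
qed

text \<open>The clause $B_1(G) = \overline{B(G)}$ is an instance of the successor step.\<close>

lemma (in topological_group) FC_step_one: "FC_step G T {\<one>} = T closure_of FC_elements G T"
proof -
  let ?Q = "G Mod {\<one>}" and ?TQ = "coset_topology G T {\<one>}"
  let ?q = "\<lambda>x. {\<one>} #> x"
  interpret one: normal "{\<one>}" G by (rule one_is_normal)
  have q: "?q x = {x}" if "x \<in> carrier G" for x
    using that by (simp add: r_coset_def)
  have inj: "inj_on ?q (carrier G)"
    by (rule inj_onI) (simp add: q)
  have hom: "homeomorphic_map T ?TQ ?q"
    using inj unfolding homeomorphic_map_def coset_topology_def topspace_carrier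
    by (simp add: quotient_map_quotient_topology)
  have car: "carrier ?Q = ?q ` carrier G"
    by (rule carrier_FactGroup)
  have conj_sub: "conjugates G x \<subseteq> carrier G" if "x \<in> carrier G" for x
    using that by (auto simp: conjugates_def)
  have conj: "conjugates ?Q (?q x) = ?q ` conjugates G x" if x: "x \<in> carrier G" for x
  proof -
    have "?q g <#> ?q x <#> inv\<^bsub>?Q\<^esub> (?q g) = ?q (g \<otimes> x \<otimes> inv g)"
      if g: "g \<in> carrier G" for g
    proof -
      have "inv\<^bsub>?Q\<^esub> (?q g) = ?q (inv g)"
        using g by (simp add: one.inv_FactGroup car one.rcos_inv)
      then show ?thesis using g x by (simp add: one.rcos_sum)
    qed
    then show ?thesis
      by (simp add: conjugates_def car Setcompr_eq_image image_image cong: image_cong)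
  qed
  have el: "FC_elements ?Q ?TQ = ?q ` FC_elements G T"
  proof -
    have "compactin ?TQ (?TQ closure_of conjugates ?Q (?q x)) \<longleftrightarrow>
        compactin T (T closure_of conjugates G x)" if x: "x \<in> carrier G" for x
    proof -
      have "?TQ closure_of (?q ` conjugates G x) = ?q ` (T closure_of conjugates G x)"
        by (rule homeomorphic_map_closure_of[OF hom]) (simp add: topspace_carrier conj_sub x)
      then show ?thesis
        using homeomorphic_map_compactness[OF hom closure_of_subset_topspace]
        by (simp add: conj x)
    qed
    then show ?thesis by (auto simp: FC_elements_def car)
  qed
  have "?TQ closure_of (?q ` FC_elements G T) = ?q ` (T closure_of FC_elements G T)"
    by (rule homeomorphic_map_closure_of[OF hom]) (auto simp: topspace_carrier FC_elements_def)
  moreover have "T closure_of FC_elements G T \<subseteq> carrier G"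
    using closure_of_subset_topspace topspace_carrier by metis
  ultimately show ?thesis
    unfolding FC_step_def el by (auto dest: inj_onD[OF inj])
qed

definition FC_class :: "('a, 'b) monoid_scheme \<Rightarrow> 'a topology \<Rightarrow> 'a ordinal" where
  "FC_class G T = (LEAST \<alpha>. FC_series G T (ordsucc \<alpha>) = FC_series G T \<alpha>)"

definition FC_hypercentre :: "('a, 'b) monoid_scheme \<Rightarrow> 'a topology \<Rightarrow> 'a set" where
  "FC_hypercentre G T = FC_series G T (FC_class G T)"

definition FC_hypercentral :: "('a, 'b) monoid_scheme \<Rightarrow> 'a topology \<Rightarrow> bool" where
  "FC_hypercentral G T \<longleftrightarrow> FC_hypercentre G T = carrier G"

end

theory Submission
  imports Defs
begin

text \<open>HOL-Algebra uses the same token for saturation under the equality of a structure.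
  Dropping it leaves \<open>closure_of\<close> to the topological closure and avoids ambiguous
  parses.\<close>

no_notation eq_closure_of ("closure'_of\<index>")

text \<open>
  Let $K$ be a compact generating set, $H = B_{\omega_0}(G) = \overline{\bigcup_n B_n}$, and let $V$ be a
  compact neighbourhood of the identity in $H$. Every compact subset of $H$ lies in $B_n V$ for some
  $n$, by density of $\bigcup_n B_n$. Applied to the conjugates of $V$ by $K$ this gives
  $k V k^{-1} \subseteq B_n V$ for all $k \in K \cup K^{-1}$, so $B_n V$ is invariant under conjugation and
  compact modulo $B_n$; hence $V \subseteq B_{n+1}$, and $B_{n+1}$ is open in $H$.
  Therefore $H = \bigcup_n B_n$ and every compact subset of $H$ lies in some $B_m$. If the conjugacy
  class of $x$ is relatively compact modulo $H$, the relations expressing its invariance under $K$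
  involve only a compact part of $H$, thus hold modulo some $B_m$, and $x \in B_{m+1}$. If $H = G$, then
  $K$ itself lies in some $B_m$, which is therefore $G$.
\<close>

section \<open>Topological groups\<close>

lemma set_mult_memI: "x \<in> A \<Longrightarrow> y \<in> B \<Longrightarrow> x \<otimes>\<^bsub>G\<^esub> y \<in> A <#>\<^bsub>G\<^esub> B"
  by (auto simp: set_mult_def)

context topological_group
begin

section \<open>Continuity, and products of open, compact and closed sets\<close>

lemma compactin_carrier: "compactin T C \<Longrightarrow> C \<subseteq> carrier G"
  using compactin_subset_topspace topspace_carrier by blast

lemma continuous_map_group_mult:
  assumes "continuous_map X T f" "continuous_map X T g"
  shows "continuous_map X T (\<lambda>x. f x \<otimes> g x)"
proof -
  have "continuous_map X (prod_topology T T) (\<lambda>x. (f x, g x))"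
    using assms by (simp add: continuous_map_pairedI)
  from continuous_map_compose[OF this continuous_mult] show ?thesis
    by (simp add: o_def)
qed

lemma continuous_map_group_inv:
  assumes "continuous_map X T f"
  shows "continuous_map X T (\<lambda>x. inv (f x))"
  using continuous_map_compose[OF assms continuous_inv] by (simp add: o_def)

lemma continuous_map_group_const: "a \<in> carrier G \<Longrightarrow> continuous_map X T (\<lambda>x. a)"
  by (simp add: topspace_carrier)

lemmas group_continuous_intros =
  continuous_map_group_mult continuous_map_group_inv continuous_map_group_const
  continuous_map_fst continuous_map_snd continuous_map_id[unfolded id_def]

text \<open>The product is the union of the translates of \<open>U\<close> by elements of
  \<open>N\<close>, and the translate by \<open>n\<close> is the preimage of \<open>U\<close> under
  left multiplication by \<open>inv n\<close>.\<close>

lemma openin_set_mult: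
  assumes N: "N \<subseteq> carrier G" and U: "openin T U"
  shows "openin T (N <#> U)"
proof -
  have Uc: "U \<subseteq> carrier G" using openin_subset[OF U] by (simp add: topspace_carrier)
  have "N <#> U = (\<Union>n\<in>N. {x \<in> topspace T. inv n \<otimes> x \<in> U})"
  proof (intro equalityI subsetI)
    fix y assume "y \<in> N <#> U"
    then obtain n u where "n \<in> N" "u \<in> U" "y = n \<otimes> u" by (auto simp: set_mult_def)
    moreover have "inv n \<otimes> (n \<otimes> u) = u"
      using calculation N Uc by (simp add: m_assoc[symmetric] subset_iff)
    ultimately show "y \<in> (\<Union>n\<in>N. {x \<in> topspace T. inv n \<otimes> x \<in> U})"
      using N Uc by (auto simp: topspace_carrier intro!: bexI[of _ n])
  next
    fix y assume "y \<in> (\<Union>n\<in>N. {x \<in> topspace T. inv n \<otimes> x \<in> U})"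
    then obtain n where n: "n \<in> N" "y \<in> carrier G" "inv n \<otimes> y \<in> U"
      by (auto simp: topspace_carrier)
    moreover have "y = n \<otimes> (inv n \<otimes> y)"
      using n N by (simp add: m_assoc[symmetric] subset_iff)
    ultimately show "y \<in> N <#> U" by (auto simp: set_mult_def)
  qed
  moreover have "openin T {x \<in> topspace T. inv n \<otimes> x \<in> U}" if "n \<in> N" for n
    using that N U
    by (intro openin_continuous_map_preimage[of T T] group_continuous_intros) auto
  ultimately show ?thesis by auto
qed

text \<open>If \<open>U = W \<inter> H\<close> with \<open>W\<close> open in the group, then
  \<open>N <#> U = (N <#> W) \<inter> H\<close>: when \<open>n \<otimes> w\<close> and
  \<open>n\<close> lie in \<open>H\<close>, so does \<open>w\<close>.\<close>

lemma openin_set_mult_subgroup: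
  assumes H: "subgroup H G" and N: "N \<subseteq> H" and U: "openin (subtopology T H) U"
  shows "openin (subtopology T H) (N <#> U)"
proof -
  interpret H: subgroup H G by (rule H)
  obtain W where W: "openin T W" "U = W \<inter> H" using U by (auto simp: openin_subtopology)
  have Wc: "W \<subseteq> carrier G" using openin_subset[OF W(1)] by (simp add: topspace_carrier)
  have "N <#> U = (N <#> W) \<inter> H"
  proof (intro equalityI subsetI)
    fix y assume "y \<in> (N <#> W) \<inter> H"
    then obtain n w where nw: "n \<in> N" "w \<in> W" "y = n \<otimes> w" "y \<in> H" by (auto simp: set_mult_def)
    then have "w = inv n \<otimes> y"
      using N Wc by (simp add: m_assoc[symmetric] subset_iff)
    moreover have "inv n \<otimes> y \<in> H" using nw N by auto
    ultimately have "w \<in> H" by simp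
    then show "y \<in> N <#> U" using nw W by (auto simp: set_mult_def)
  qed (use N W in \<open>auto simp: set_mult_def\<close>)
  then show ?thesis
    using openin_set_mult[OF _ W(1), of N] N H.subset by (auto simp: openin_subtopology)
qed

lemma compactin_set_mult:
  assumes "compactin T C" "compactin T D"
  shows "compactin T (C <#> D)"
proof -
  have "compactin T ((\<lambda>(x, y). x \<otimes> y) ` (C \<times> D))"
    using assms by (intro image_compactin[OF _ continuous_mult]) (simp add: compactin_Times)
  moreover have "(\<lambda>(x, y). x \<otimes> y) ` (C \<times> D) = C <#> D" by (auto simp: set_mult_def)
  ultimately show ?thesis by simp
qed

lemma compactin_set_inv:
  assumes "compactin T C"
  shows "compactin T (m_inv G ` C)"
  using assms continuous_inv by (rule image_compactin)

text \<open>Projection along a compact factor is a closed map, and the product is the projection to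
  the first coordinate of the closed set of pairs \<open>(y, c)\<close> with
  \<open>y \<otimes> inv c \<in> N\<close>.\<close>

lemma closedin_set_mult:
  assumes N: "closedin T N" and C: "compactin T C"
  shows "closedin T (N <#> C)"
proof -
  let ?P = "prod_topology T (subtopology T C)"
  let ?S = "{p \<in> topspace ?P. fst p \<otimes> inv (snd p) \<in> N}"
  have Cc: "C \<subseteq> carrier G" using C by (rule compactin_carrier)
  have Nc: "N \<subseteq> carrier G" using closedin_subset[OF N] by (simp add: topspace_carrier)
  have top: "topspace ?P = carrier G \<times> C" using Cc by (auto simp: topspace_carrier)
  have f: "continuous_map ?P T fst" by (rule continuous_map_fst)
  have "continuous_map ?P (subtopology T C) snd" by (rule continuous_map_snd)
  then have s: "continuous_map ?P T snd" by (simp add: continuous_map_in_subtopology)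
  have "continuous_map ?P T (\<lambda>p. fst p \<otimes> inv (snd p))"
    by (intro continuous_map_group_mult continuous_map_group_inv f s)
  then have "closedin ?P ?S" using N by (rule closedin_continuous_map_preimage)
  moreover have "closed_map ?P T fst"
    using C by (intro closed_map_fst) (simp add: compact_space_subtopology)
  ultimately have "closedin T (fst ` ?S)" by (simp add: closed_map_def)
  moreover have "fst ` ?S = N <#> C"
  proof (intro equalityI subsetI)
    fix y assume "y \<in> fst ` ?S"
    then obtain c where c: "y \<in> carrier G" "c \<in> C" "y \<otimes> inv c \<in> N" unfolding top by auto
    then have "y = (y \<otimes> inv c) \<otimes> c" using Cc by (simp add: m_assoc subset_iff)
    then show "y \<in> N <#> C" using c by (auto simp: set_mult_def)
  next
    fix y assume "y \<in> N <#> C"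
    then obtain n c where "n \<in> N" "c \<in> C" "y = n \<otimes> c" by (auto simp: set_mult_def)
    moreover have "n \<otimes> c \<otimes> inv c = n"
      using calculation Cc Nc by (simp add: m_assoc subset_iff)
    ultimately have "(y, c) \<in> ?S" unfolding top using Cc Nc by auto
    then show "y \<in> fst ` ?S" by (rule rev_image_eqI) simp
  qed
  ultimately show ?thesis by simp
qed

section \<open>Closures of subgroups\<close>

lemma subgroup_closure_of:
  assumes "subgroup A G"
  shows "subgroup (T closure_of A) G"
proof -
  interpret A: subgroup A G by (rule assms)
  have A: "A \<subseteq> T closure_of A"
    by (rule closure_of_subset) (simp add: topspace_carrier A.subset)
  have sub: "T closure_of A \<subseteq> carrier G"
    using closure_of_subset_topspace topspace_carrier by metis
  have div: "x \<otimes> inv y \<in> T closure_of A"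
    if "x \<in> T closure_of A" "y \<in> T closure_of A" for x y
  proof -
    have "continuous_map (prod_topology T T) T (\<lambda>p. fst p \<otimes> inv (snd p))"
      by (intro group_continuous_intros)
    from continuous_map_image_closure_subset[OF this, of "A \<times> A"]
    have "(\<lambda>p. fst p \<otimes> inv (snd p)) ` ((T closure_of A) \<times> (T closure_of A)) \<subseteq>
        T closure_of ((\<lambda>p. fst p \<otimes> inv (snd p)) ` (A \<times> A))"
      by (simp add: closure_of_Times)
    also have "\<dots> \<subseteq> T closure_of A" by (rule closure_of_mono) auto
    finally show ?thesis using that by (force simp: image_subset_iff)
  qed
  have inv: "inv y \<in> T closure_of A" if "y \<in> T closure_of A" for y
    using div[of \<one> y] A that sub A.one_closed by (simp add: subset_iff)
  show ?thesis
  proof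
    show "x \<otimes> y \<in> T closure_of A" if "x \<in> T closure_of A" "y \<in> T closure_of A" for x y
      using div[OF that(1) inv[OF that(2)]] that sub by (simp add: subset_iff)
  qed (use A sub inv in auto)
qed

lemma normal_closure_of:
  assumes "A \<lhd> G"
  shows "T closure_of A \<lhd> G"
proof -
  interpret A: normal A G by (rule assms)
  have "g \<otimes> x \<otimes> inv g \<in> T closure_of A" if g: "g \<in> carrier G" and x: "x \<in> T closure_of A" for g x
  proof -
    have "continuous_map T T (\<lambda>x. g \<otimes> x \<otimes> inv g)"
      using g by (intro group_continuous_intros) auto
    from continuous_map_image_closure_subset[OF this]
    have "(\<lambda>x. g \<otimes> x \<otimes> inv g) ` (T closure_of A) \<subseteq> T closure_of ((\<lambda>x. g \<otimes> x \<otimes> inv g) ` A)" .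
    also have "\<dots> \<subseteq> T closure_of A"
      using g by (intro closure_of_mono) (auto intro: A.inv_op_closed2)
    finally show ?thesis using x by auto
  qed
  then show ?thesis
    by (simp add: normal_inv_iff subgroup_closure_of A.subgroup_axioms)
qed

text \<open>For \<open>h\<close> in the closure, the points \<open>x\<close> with
  \<open>inv x \<otimes> h\<close> in a given open neighbourhood of the identity form an open
  neighbourhood of \<open>h\<close>, so one of them lies in \<open>A\<close>.\<close>

lemma closure_of_subset_set_mult:
  assumes A: "subgroup A G" and U: "openin (subtopology T (T closure_of A)) U" and "\<one> \<in> U"
  shows "T closure_of A \<subseteq> A <#> U"
proof
  let ?H = "T closure_of A"
  interpret A: subgroup A G by (rule A)
  interpret H: subgroup ?H G using A by (rule subgroup_closure_of)
  fix h assume h: "h \<in> ?H"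
  obtain W where W: "openin T W" "U = W \<inter> ?H" using U by (auto simp: openin_subtopology)
  have "openin T {x \<in> topspace T. inv x \<otimes> h \<in> W}"
    using W(1) h by (intro openin_continuous_map_preimage[of T T] group_continuous_intros) auto
  moreover have "h \<in> {x \<in> topspace T. inv x \<otimes> h \<in> W}"
    using h W(2) \<open>\<one> \<in> U\<close> by (auto simp: topspace_carrier)
  ultimately have "\<exists>a. a \<in> A \<and> a \<in> {x \<in> topspace T. inv x \<otimes> h \<in> W}"
    using h[unfolded in_closure_of] by meson
  then obtain a where a: "a \<in> A" "inv a \<otimes> h \<in> W" by blast
  have "A \<subseteq> ?H" by (rule closure_of_subset) (simp add: topspace_carrier A.subset)
  then have "inv a \<otimes> h \<in> U" using a h W(2) by auto
  moreover have "h = a \<otimes> (inv a \<otimes> h)" using a h by (simp add: m_assoc[symmetric])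
  ultimately show "h \<in> A <#> U" using a by (auto simp: set_mult_def)
qed

end

section \<open>Increasing open covers, and conjugation by generators\<close>

lemma compactin_subset_chain:
  fixes U :: "nat \<Rightarrow> 'a set"
  assumes P: "compactin T P" "P \<subseteq> H"
    and U: "\<And>n. openin (subtopology T H) (U n)" "incseq U" "P \<subseteq> (\<Union>n. U n)"
  shows "\<exists>n. P \<subseteq> U n"
proof -
  have "compactin (subtopology T H) P" using P by (simp add: compactin_subtopology)
  then obtain F where F: "finite F" "F \<subseteq> range U" "P \<subseteq> \<Union>F"
    using U(1,3) unfolding compactin_def by (metis (no_types, lifting) imageE)
  then obtain I where I: "finite I" "F = U ` I" by (meson finite_subset_image)
  \<comment> \<open>The added index 0 keeps \<open>Max\<close> meaningful when the finite subcover
    is empty.\<close>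
  have "P \<subseteq> U (Max (insert 0 I))"
  proof
    fix x assume "x \<in> P"
    then obtain i where "i \<in> I" "x \<in> U i" using F I by auto
    moreover have "U i \<subseteq> U (Max (insert 0 I))"
      using \<open>i \<in> I\<close> I by (intro incseqD[OF U(2)] Max_ge) auto
    ultimately show "x \<in> U (Max (insert 0 I))" by auto
  qed
  then show ?thesis ..
qed

text \<open>Induction over the generated subgroup. Inverses of generators appear in the hypothesis
  because mapping \<open>M\<close> into itself under conjugation by \<open>k\<close> does not imply
  the same for \<open>inv k\<close>.\<close>

lemma (in group) generate_conj_closed:
  assumes g: "g \<in> generate G K" and K: "K \<subseteq> carrier G" and M: "M \<subseteq> carrier G"
    and conj: "\<And>k s. k \<in> K \<union> m_inv G ` K \<Longrightarrow> s \<in> M \<Longrightarrow> k \<otimes> s \<otimes> inv k \<in> M"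
    and s: "s \<in> M"
  shows "g \<otimes> s \<otimes> inv g \<in> M"
  using g s
proof (induction arbitrary: s)
  case one
  then show ?case using M by auto
next
  case (incl h)
  then show ?case by (intro conj) auto
next
  case (inv h)
  then show ?case by (intro conj) auto
next
  case (eng h1 h2)
  have c: "h1 \<in> carrier G" "h2 \<in> carrier G" "s \<in> carrier G"
    using eng generate_in_carrier[OF K] M by auto
  have "h1 \<otimes> h2 \<otimes> s \<otimes> inv (h1 \<otimes> h2) = h1 \<otimes> (h2 \<otimes> s \<otimes> inv h2) \<otimes> inv h1"
    using c by (simp add: inv_mult_group m_assoc)
  then show ?case using eng by simp
qed

section \<open>The successor step\<close>

text \<open>For a closed normal subgroup \<open>N\<close> of a locally compact group this is the
  preimage of the subgroup of elements of the quotient with relatively compact class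
  (\<open>rcos_mem_FC_elements\<close>). Being phrased inside the group itself, it lets different
  stages be compared without passing between quotients.\<close>

definition FC_modulo :: "('a, 'b) monoid_scheme \<Rightarrow> 'a topology \<Rightarrow> 'a set \<Rightarrow> 'a set" where
  "FC_modulo G T N =
    {x \<in> carrier G. \<exists>C. compactin T C \<and> conjugates G x \<subseteq> N <#>\<^bsub>G\<^esub> C}"

section \<open>Relatively compact classes modulo a normal subgroup\<close>

lemma (in topological_group) conjugates_carrier: "x \<in> carrier G \<Longrightarrow> conjugates G x \<subseteq> carrier G"
  by (auto simp: conjugates_def)

lemma (in topological_group) subset_FC_modulo:
  assumes "N \<lhd> G"
  shows "N \<subseteq> FC_modulo G T N"
proof
  interpret N: normal N G by (rule assms)
  fix x assume x: "x \<in> N"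
  have "conjugates G x \<subseteq> N" using x by (auto simp: conjugates_def N.inv_op_closed2)
  moreover have "N <#> {\<one>} = N" by (auto simp: set_mult_def)
  ultimately show "x \<in> FC_modulo G T N"
    using x by (auto simp: FC_modulo_def topspace_carrier intro!: exI[of _ "{\<one>}"])
qed

text \<open>If \<open>C\<close> and \<open>D\<close> are witnesses for two elements, then
  \<open>C <#> D\<close> is one for the product and the set of inverses of \<open>C\<close> is one
  for the inverse: normality of \<open>N\<close> allows its elements to be moved to the left. A
  conjugate has its class inside the original one, so the same witness serves.\<close>

lemma (in topological_group) normal_FC_modulo:
  assumes "N \<lhd> G"
  shows "FC_modulo G T N \<lhd> G"
proof -
  interpret N: normal N G by (rule assms)
  show ?thesis
    unfolding normal_inv_iff
  proof (intro conjI ballI)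
    show "subgroup (FC_modulo G T N) G"
    proof
      show "FC_modulo G T N \<subseteq> carrier G" by (auto simp: FC_modulo_def)
      show "\<one> \<in> FC_modulo G T N" using subset_FC_modulo[OF assms] by auto
    next
      fix x y assume "x \<in> FC_modulo G T N" "y \<in> FC_modulo G T N"
      then obtain C D where C: "x \<in> carrier G" "compactin T C" "conjugates G x \<subseteq> N <#> C"
        and D: "y \<in> carrier G" "compactin T D" "conjugates G y \<subseteq> N <#> D"
        by (auto simp: FC_modulo_def)
      have "g \<otimes> (x \<otimes> y) \<otimes> inv g \<in> N <#> (C <#> D)" if g: "g \<in> carrier G" for g
      proof -
        have "g \<otimes> x \<otimes> inv g \<in> N <#> C" "g \<otimes> y \<otimes> inv g \<in> N <#> D"
          using g C D by (auto simp: conjugates_def)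
        then obtain n c m d where *: "n \<in> N" "c \<in> C" "m \<in> N" "d \<in> D"
          "g \<otimes> x \<otimes> inv g = n \<otimes> c" "g \<otimes> y \<otimes> inv g = m \<otimes> d"
          by (auto simp: set_mult_def)
        have c: "n \<in> carrier G" "c \<in> carrier G" "m \<in> carrier G" "d \<in> carrier G"
          using * C D compactin_carrier by auto
        have "g \<otimes> (x \<otimes> y) \<otimes> inv g = (g \<otimes> x \<otimes> inv g) \<otimes> (g \<otimes> y \<otimes> inv g)"
          using g C(1) D(1) by (simp add: m_assoc inv_solve_left)
        also have "\<dots> = (n \<otimes> (c \<otimes> m \<otimes> inv c)) \<otimes> (c \<otimes> d)"
          using c * by (simp add: m_assoc inv_solve_left)
        finally have "g \<otimes> (x \<otimes> y) \<otimes> inv g = \<dots>" .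
        moreover have "n \<otimes> (c \<otimes> m \<otimes> inv c) \<in> N" using * c by (simp add: N.inv_op_closed2)
        ultimately show ?thesis using * unfolding set_mult_def by blast
      qed
      then show "x \<otimes> y \<in> FC_modulo G T N"
        using C D compactin_set_mult[of C D]
        by (auto simp: FC_modulo_def conjugates_def)
    next
      fix x assume "x \<in> FC_modulo G T N"
      then obtain C where C: "x \<in> carrier G" "compactin T C" "conjugates G x \<subseteq> N <#> C"
        by (auto simp: FC_modulo_def)
      have "g \<otimes> inv x \<otimes> inv g \<in> N <#> (m_inv G ` C)" if g: "g \<in> carrier G" for g
      proof -
        have "g \<otimes> x \<otimes> inv g \<in> N <#> C" using g C by (auto simp: conjugates_def)
        then obtain n c where *: "n \<in> N" "c \<in> C" "g \<otimes> x \<otimes> inv g = n \<otimes> c"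
          by (auto simp: set_mult_def)
        have c: "n \<in> carrier G" "c \<in> carrier G" using * C compactin_carrier by auto
        have "g \<otimes> inv x \<otimes> inv g = inv (g \<otimes> x \<otimes> inv g)"
          using g C(1) by (simp add: inv_mult_group m_assoc)
        also have "\<dots> = (inv c \<otimes> inv n \<otimes> c) \<otimes> inv c"
          using c * by (simp add: inv_mult_group m_assoc)
        finally have "g \<otimes> inv x \<otimes> inv g = \<dots>" .
        moreover have "inv c \<otimes> inv n \<otimes> c \<in> N" using * c by (simp add: N.inv_op_closed1)
        ultimately show ?thesis using * unfolding set_mult_def by blast
      qed
      then show "inv x \<in> FC_modulo G T N"
        using C compactin_set_inv[of C] by (auto simp: FC_modulo_def conjugates_def)
    qed
  next
    fix h x assume h: "h \<in> carrier G" and x: "x \<in> FC_modulo G T N"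
    then have xc: "x \<in> carrier G" by (auto simp: FC_modulo_def)
    have "conjugates G (h \<otimes> x \<otimes> inv h) \<subseteq> conjugates G x"
    proof
      fix y assume "y \<in> conjugates G (h \<otimes> x \<otimes> inv h)"
      then obtain g where g: "g \<in> carrier G" "y = g \<otimes> (h \<otimes> x \<otimes> inv h) \<otimes> inv g"
        by (auto simp: conjugates_def)
      then have "y = (g \<otimes> h) \<otimes> x \<otimes> inv (g \<otimes> h)"
        using h xc by (simp add: inv_mult_group m_assoc)
      then show "y \<in> conjugates G x" using g h by (auto simp: conjugates_def)
    qed
    then show "h \<otimes> x \<otimes> inv h \<in> FC_modulo G T N"
      using h x by (auto simp: FC_modulo_def)
  qed
qed

section \<open>The quotient by a normal subgroup\<close>

lemma (in topological_group) rcos_image_eq_set_mult: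
  assumes "N \<lhd> G" "S \<subseteq> carrier G"
  shows "{x \<in> carrier G. N #> x \<in> (\<lambda>x. N #> x) ` S} = N <#> S"
proof (intro equalityI subsetI)
  interpret N: normal N G by (rule assms)
  fix x assume "x \<in> {x \<in> carrier G. N #> x \<in> (\<lambda>x. N #> x) ` S}"
  then obtain s where "x \<in> carrier G" "s \<in> S" "N #> x = N #> s" by auto
  then have "x \<in> N #> s" using rcos_self[OF _ N.subgroup_axioms] by auto
  then show "x \<in> N <#> S" using \<open>s \<in> S\<close> by (auto simp: r_coset_def set_mult_def)
next
  interpret N: normal N G by (rule assms)
  fix x assume "x \<in> N <#> S"
  then obtain n s where ns: "n \<in> N" "s \<in> S" "x = n \<otimes> s" by (auto simp: set_mult_def)
  then have "x \<in> N #> s" by (auto simp: r_coset_def)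
  then have "N #> x = N #> s"
    using repr_independence[of x N s] ns assms N.subgroup_axioms by auto
  then show "x \<in> {x \<in> carrier G. N #> x \<in> (\<lambda>x. N #> x) ` S}" using ns assms by auto
qed

lemma (in topological_group) conjugates_FactGroup:
  assumes "N \<lhd> G" and x: "x \<in> carrier G"
  shows "conjugates (G Mod N) (N #> x) = (\<lambda>y. N #> y) ` conjugates G x"
proof -
  interpret N: normal N G by (rule assms)
  have "(N #> g) <#> (N #> x) <#> inv\<^bsub>G Mod N\<^esub> (N #> g) = N #> (g \<otimes> x \<otimes> inv g)"
    if g: "g \<in> carrier G" for g
  proof -
    have "inv\<^bsub>G Mod N\<^esub> (N #> g) = N #> inv g"
      using g by (simp add: N.inv_FactGroup carrier_FactGroup N.rcos_inv)
    then show ?thesis using g x by (simp add: N.rcos_sum)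
  qed
  then show ?thesis
    by (simp add: conjugates_def carrier_FactGroup Setcompr_eq_image image_image cong: image_cong)
qed

text \<open>The preimage of the image of \<open>U\<close> is the saturation \<open>N <#> U\<close>,
  a union of translates of an open set.\<close>

lemma (in topological_group) open_map_rcos:
  assumes "N \<lhd> G"
  shows "open_map T (coset_topology G T N) (\<lambda>x. N #> x)"
proof -
  interpret N: normal N G by (rule assms)
  show ?thesis
    unfolding open_map_def coset_topology_def openin_quotient_topology topspace_carrier
  proof (intro allI impI conjI)
    fix U assume U: "openin T U"
    then have Uc: "U \<subseteq> carrier G" using openin_subset topspace_carrier by metis
    then show "(\<lambda>x. N #> x) ` U \<subseteq> (\<lambda>x. N #> x) ` carrier G" by auto
    show "openin T {x \<in> carrier G. N #> x \<in> (\<lambda>x. N #> x) ` U}"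
      using openin_set_mult[OF N.subset U] rcos_image_eq_set_mult[OF assms Uc] by simp
  qed
qed

lemma (in topological_group) quotient_map_rcos:
  "quotient_map T (coset_topology G T N) (\<lambda>x. N #> x)"
  unfolding coset_topology_def by (rule quotient_map_quotient_topology)

text \<open>The core is a statement on arbitrary subsets \<open>S\<close>: the image of
  \<open>S\<close> is relatively compact in the quotient exactly when a compact \<open>C\<close>
  satisfies \<open>S \<subseteq> N <#> C\<close>. It is then applied to conjugacy classes.\<close>

lemma (in locally_compact_group) rcos_mem_FC_elements:
  assumes N: "N \<lhd> G" "closedin T N"
  shows "{x \<in> carrier G. N #> x \<in> FC_elements (G Mod N) (coset_topology G T N)} = FC_modulo G T N"
proof -
  interpret N: normal N G by (rule N)
  let ?q = "\<lambda>x. N #> x" and ?Q = "coset_topology G T N"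
  have cont: "continuous_map T ?Q ?q"
    using quotient_map_rcos by (rule quotient_imp_continuous_map)
  have "compactin ?Q (?Q closure_of (?q ` S)) \<longleftrightarrow> (\<exists>C. compactin T C \<and> S \<subseteq> N <#> C)"
    if S: "S \<subseteq> carrier G" for S
  proof
    assume L: "compactin ?Q (?Q closure_of (?q ` S))"
    \<comment> \<open>Local compactness provides these open sets around every point. Their images
      are open and cover the compact closure; the compact sets containing a finite subfamily unite
      to the required \<open>C\<close>.\<close>
    let ?\<U> = "{U. openin T U \<and> (\<exists>C. compactin T C \<and> U \<subseteq> C)}"
    have cov: "?Q closure_of (?q ` S) \<subseteq> \<Union>((`) ?q ` ?\<U>)"
    proof
      fix y assume "y \<in> ?Q closure_of (?q ` S)"
      then have "y \<in> topspace ?Q" by (simp add: in_closure_of)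
      then obtain x where x: "x \<in> topspace T" "y = ?q x" by (auto simp: coset_topology_def)
      then obtain U C where "openin T U" "compactin T C" "x \<in> U" "U \<subseteq> C"
        using locally_compact unfolding locally_compact_space_def by blast
      then show "y \<in> \<Union>((`) ?q ` ?\<U>)" using x by blast
    qed
    moreover have "\<forall>W \<in> (`) ?q ` ?\<U>. openin ?Q W"
      using open_map_rcos[OF N(1)] by (auto simp: open_map_def)
    ultimately have "\<exists>F. finite F \<and> F \<subseteq> (`) ?q ` ?\<U> \<and> ?Q closure_of (?q ` S) \<subseteq> \<Union>F"
      using L unfolding compactin_def by blast
    then obtain F where F: "finite F" "F \<subseteq> ?\<U>" "?Q closure_of (?q ` S) \<subseteq> \<Union>((`) ?q ` F)"
      by (metis (no_types, lifting) finite_subset_image)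
    from F(2) have "\<forall>U\<in>F. \<exists>C. compactin T C \<and> U \<subseteq> C" by blast
    then obtain c where c: "\<And>U. U \<in> F \<Longrightarrow> compactin T (c U) \<and> U \<subseteq> c U" by metis
    let ?C = "\<Union>(c ` F)"
    have C: "compactin T ?C" using F(1) c by (intro compactin_Union) auto
    have "?q ` S \<subseteq> ?q ` ?C"
    proof -
      have "?q ` S \<subseteq> topspace ?Q" using S by (auto simp: coset_topology_def topspace_carrier)
      then have "?q ` S \<subseteq> ?Q closure_of (?q ` S)" by (rule closure_of_subset)
      also have "\<dots> \<subseteq> \<Union>((`) ?q ` F)" by (rule F(3))
      also have "\<dots> \<subseteq> ?q ` ?C" using c by blast
      finally show ?thesis .
    qed
    then have "S \<subseteq> N <#> ?C"
      using rcos_image_eq_set_mult[OF N(1) compactin_carrier[OF C]] S by blast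
    then show "\<exists>C. compactin T C \<and> S \<subseteq> N <#> C" using C by blast
  next
    assume "\<exists>C. compactin T C \<and> S \<subseteq> N <#> C"
    then obtain C where C: "compactin T C" "S \<subseteq> N <#> C" by blast
    note Cc = compactin_carrier[OF C(1)]
    \<comment> \<open>Closedness of \<open>N\<close> enters here: the preimage of the image of
      \<open>C\<close> is \<open>N <#> C\<close>, which is closed, so the image of \<open>C\<close>
      is a closed compact set containing the image of \<open>S\<close>.\<close>
    have "closedin T {x \<in> topspace T. ?q x \<in> ?q ` C}"
      using closedin_set_mult[OF N(2) C(1)] rcos_image_eq_set_mult[OF N(1) Cc]
      by (simp add: topspace_carrier)
    moreover have "?q ` C \<subseteq> topspace ?Q" using Cc by (auto simp: coset_topology_def topspace_carrier)
    ultimately have cl: "closedin ?Q (?q ` C)"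
      using quotient_map_rcos[of N] unfolding quotient_map_closedin by blast
    have "?q ` S \<subseteq> ?q ` C"
      using C(2) S rcos_image_eq_set_mult[OF N(1) Cc] by blast
    then have "?Q closure_of (?q ` S) \<subseteq> ?q ` C" using cl by (rule closure_of_minimal)
    moreover have "compactin ?Q (?q ` C)" using C(1) cont by (rule image_compactin)
    ultimately show "compactin ?Q (?Q closure_of (?q ` S))"
      using closed_compactin closedin_closure_of by metis
  qed
  note char = this
  have "compactin ?Q (?Q closure_of conjugates (G Mod N) (?q x)) \<longleftrightarrow>
      (\<exists>C. compactin T C \<and> conjugates G x \<subseteq> N <#> C)" if "x \<in> carrier G" for x
    using char[OF conjugates_carrier[OF that]] conjugates_FactGroup[OF N(1) that] by simp
  then show ?thesis by (auto simp: FC_elements_def FC_modulo_def carrier_FactGroup)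
qed

text \<open>Under a continuous open map, taking preimages commutes with closure. Openness gives the
  inclusion from left to right, continuity the other one.\<close>

lemma (in locally_compact_group) FC_step_eq_closure:
  assumes N: "N \<lhd> G" "closedin T N"
  shows "FC_step G T N = T closure_of FC_modulo G T N"
proof -
  let ?q = "\<lambda>x. N #> x" and ?Q = "coset_topology G T N"
  let ?E = "FC_elements (G Mod N) ?Q"
  have cont: "continuous_map T ?Q ?q"
    using quotient_map_rcos by (rule quotient_imp_continuous_map)
  have E: "{x \<in> carrier G. ?q x \<in> ?E} = FC_modulo G T N" by (rule rcos_mem_FC_elements[OF N])
  show ?thesis
  proof (intro equalityI subsetI)
    fix x assume "x \<in> FC_step G T N"
    then have x: "x \<in> carrier G" "?q x \<in> ?Q closure_of ?E" by (auto simp: FC_step_def)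
    show "x \<in> T closure_of FC_modulo G T N"
      unfolding in_closure_of
    proof (intro conjI allI impI)
      fix U assume U: "x \<in> U \<and> openin T U"
      then have "openin ?Q (?q ` U)" "?q x \<in> ?q ` U"
        using open_map_rcos[OF N(1)] by (auto simp: open_map_def)
      then obtain y where "y \<in> ?E" "y \<in> ?q ` U"
        using x(2)[unfolded in_closure_of] by meson
      moreover have "U \<subseteq> carrier G" using U openin_subset topspace_carrier by metis
      ultimately show "\<exists>y. y \<in> FC_modulo G T N \<and> y \<in> U" using E by blast
    qed (simp add: x topspace_carrier)
  next
    fix x assume x: "x \<in> T closure_of FC_modulo G T N"
    then have "?q x \<in> ?Q closure_of (?q ` FC_modulo G T N)"
      using continuous_map_image_closure_subset[OF cont] by blast
    also have "\<dots> \<subseteq> ?Q closure_of ?E" using E by (intro closure_of_mono) blast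
    finally show "x \<in> FC_step G T N"
      using x closure_of_subset_topspace[of T] by (auto simp: FC_step_def topspace_carrier)
  qed
qed

section \<open>The finite stages\<close>

text \<open>The finite stages of the series, indexed by natural numbers so that the topological
  argument stays free of ordinals; \<open>FC_series_ordinal_of_nat\<close> makes the link.\<close>

definition FC_iter :: "('a, 'b) monoid_scheme \<Rightarrow> 'a topology \<Rightarrow> nat \<Rightarrow> 'a set" where
  "FC_iter G T n = (FC_step G T ^^ n) {\<one>\<^bsub>G\<^esub>}"

lemma FC_iter_0 [simp]: "FC_iter G T 0 = {\<one>\<^bsub>G\<^esub>}"
  and FC_iter_Suc [simp]: "FC_iter G T (Suc n) = FC_step G T (FC_iter G T n)"
  by (simp_all add: FC_iter_def)

context locally_compact_group
begin

abbreviation "B \<equiv> FC_iter G T"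
abbreviation "A \<equiv> \<Union>n. B n"
abbreviation "H \<equiv> T closure_of A"

text \<open>One induction carries both properties, since rewriting the next stage by
  \<open>FC_step_eq_closure\<close> requires both of the current one. The Hausdorff property starts
  it.\<close>

lemma FC_iter_normal_closed: "B n \<lhd> G \<and> closedin T (B n)"
proof (induction n)
  case 0
  show ?case
    using one_is_normal Hausdorff by (simp add: closedin_Hausdorff_singleton topspace_carrier)
next
  case (Suc n)
  then show ?case by (simp add: FC_step_eq_closure normal_closure_of normal_FC_modulo)
qed

lemmas FC_iter_normal = FC_iter_normal_closed[THEN conjunct1]
lemmas FC_iter_closed = FC_iter_normal_closed[THEN conjunct2]

lemma FC_iter_carrier: "B n \<subseteq> carrier G"
  using closedin_subset[OF FC_iter_closed] by (simp add: topspace_carrier)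

text \<open>The criterion by which elements are shown below to belong to the next stage: it suffices
  to exhibit a compact witness.\<close>

lemma FC_modulo_subset_FC_iter: "FC_modulo G T (B n) \<subseteq> B (Suc n)"
  unfolding FC_iter_Suc FC_step_eq_closure[OF FC_iter_normal FC_iter_closed]
  by (rule closure_of_subset) (auto simp: FC_modulo_def topspace_carrier)

lemma incseq_FC_iter: "incseq B"
  using subset_FC_modulo[OF FC_iter_normal] FC_modulo_subset_FC_iter
  by (intro incseq_SucI) (rule subset_trans)

lemma FC_union_normal: "A \<lhd> G"
  unfolding normal_inv_iff
proof (intro conjI ballI)
  show "subgroup A G"
  proof
    show "A \<subseteq> carrier G" using FC_iter_carrier by auto
    have "\<one> \<in> B 0" by simp
    then show "\<one> \<in> A" by blast
  next
    fix x y assume "x \<in> A" "y \<in> A"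
    then obtain i j where "x \<in> B i" "y \<in> B j" by auto
    then have "x \<in> B (max i j)" "y \<in> B (max i j)"
      using incseqD[OF incseq_FC_iter, of i "max i j"] incseqD[OF incseq_FC_iter, of j "max i j"]
      by auto
    then have "x \<otimes> y \<in> B (max i j)"
      by (intro subgroup.m_closed normal_imp_subgroup FC_iter_normal)
    then show "x \<otimes> y \<in> A" by blast
  next
    fix x assume "x \<in> A"
    then show "inv x \<in> A"
      using subgroup.m_inv_closed[OF normal_imp_subgroup[OF FC_iter_normal]] by blast
  qed
  fix g x assume "g \<in> carrier G" "x \<in> A"
  then show "g \<otimes> x \<otimes> inv g \<in> A"
    using normal.inv_op_closed2[OF FC_iter_normal] by blast
qed

lemma FC_limit_normal: "H \<lhd> G"
  using FC_union_normal by (rule normal_closure_of)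

lemma FC_iter_subset_limit: "B n \<subseteq> H"
proof -
  have "A \<subseteq> H" using FC_iter_carrier by (intro closure_of_subset) (auto simp: topspace_carrier)
  then show ?thesis by auto
qed

section \<open>Compact subsets of the limit stage\<close>

lemma compactin_limit_subset_FC_iter_mult:
  assumes P: "compactin T P" "P \<subseteq> H" and U: "openin (subtopology T H) U" "\<one> \<in> U"
  shows "\<exists>n. P \<subseteq> B n <#> U"
proof (rule compactin_subset_chain[OF P])
  show "openin (subtopology T H) (B n <#> U)" for n
    using FC_iter_subset_limit U(1)
    by (intro openin_set_mult_subgroup normal_imp_subgroup FC_limit_normal)
  show "incseq (\<lambda>n. B n <#> U)"
    using incseqD[OF incseq_FC_iter] by (fastforce simp: incseq_def set_mult_def)
  \<comment> \<open>Density of \<open>A\<close> in \<open>H\<close> makes the increasing open sets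
    \<open>B n <#> U\<close> cover all of \<open>H\<close>.\<close>
  have "H \<subseteq> A <#> U"
    using U by (intro closure_of_subset_set_mult normal_imp_subgroup FC_union_normal)
  then show "P \<subseteq> (\<Union>n. B n <#> U)" using P(2) by (auto simp: set_mult_def)
qed

lemma mult_FC_iter_FC_iter: "B m <#> (B m <#> S) \<subseteq> B m <#> S" if "S \<subseteq> carrier G"
proof
  interpret N: normal "B m" G by (rule FC_iter_normal)
  fix y assume "y \<in> B m <#> (B m <#> S)"
  then obtain a b s where y: "a \<in> B m" "b \<in> B m" "s \<in> S" "y = a \<otimes> (b \<otimes> s)"
    by (auto simp: set_mult_def)
  then have "y = (a \<otimes> b) \<otimes> s" using that by (simp add: m_assoc subset_iff)
  then show "y \<in> B m <#> S" using y by (auto simp: set_mult_def)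
qed

text \<open>Conjugating \<open>b \<otimes> s\<close> by \<open>k\<close> conjugates both factors,
  and \<open>b\<close> stays in \<open>B m\<close> by normality. Hence invariance of
  \<open>B m <#> S\<close> has to be tested only on \<open>S\<close> and only for generators and
  their inverses.\<close>

lemma FC_iter_mult_conj_closed:
  assumes K: "K \<subseteq> carrier G" "generate G K = carrier G" and S: "S \<subseteq> carrier G"
    and conj: "\<And>k s. k \<in> K \<union> m_inv G ` K \<Longrightarrow> s \<in> S \<Longrightarrow> k \<otimes> s \<otimes> inv k \<in> B m <#> S"
    and x: "x \<in> B m <#> S"
  shows "conjugates G x \<subseteq> B m <#> S"
proof -
  interpret N: normal "B m" G by (rule FC_iter_normal)
  have M: "B m <#> S \<subseteq> carrier G" using S by (auto simp: set_mult_def)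
  have "k \<otimes> y \<otimes> inv k \<in> B m <#> S" if k: "k \<in> K \<union> m_inv G ` K" and y: "y \<in> B m <#> S" for k y
  proof -
    have kc: "k \<in> carrier G" using k K(1) by auto
    obtain b s where bs: "b \<in> B m" "s \<in> S" "y = b \<otimes> s" using y by (auto simp: set_mult_def)
    then have c: "b \<in> carrier G" "s \<in> carrier G" using S by auto
    then have "k \<otimes> y \<otimes> inv k = (k \<otimes> b \<otimes> inv k) \<otimes> (k \<otimes> s \<otimes> inv k)"
      using kc bs(3) by (simp add: m_assoc inv_solve_left)
    moreover have "k \<otimes> b \<otimes> inv k \<in> B m" using bs(1) kc by (rule N.inv_op_closed2[rotated])
    moreover have "k \<otimes> s \<otimes> inv k \<in> B m <#> S" using k bs(2) by (rule conj)
    ultimately have "k \<otimes> y \<otimes> inv k \<in> B m <#> (B m <#> S)" unfolding set_mult_def by blast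
    then show ?thesis using mult_FC_iter_FC_iter[OF S] by blast
  qed
  then have "g \<otimes> x \<otimes> inv g \<in> B m <#> S" if "g \<in> carrier G" for g
    using generate_conj_closed[OF _ K(1) M _ x] that K(2) by blast
  then show ?thesis by (auto simp: conjugates_def)
qed

lemma FC_iter_open_in_limit:
  assumes K: "compactin T K" "generate G K = carrier G"
  shows "\<exists>n. \<forall>m\<ge>n. openin (subtopology T H) (B m)"
proof -
  note Kc = compactin_carrier[OF K(1)]
  interpret H: normal H G by (rule FC_limit_normal)
  have "\<one> \<in> topspace T" by (simp add: topspace_carrier)
  then obtain U V where UV: "openin T U" "compactin T V" "\<one> \<in> U" "U \<subseteq> V"
    using locally_compact unfolding locally_compact_space_def by meson
  have V: "compactin T (V \<inter> H)" using UV(2) by (simp add: compact_Int_closedin)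
  have Vc: "V \<inter> H \<subseteq> carrier G" by auto
  have U: "openin (subtopology T H) (U \<inter> H)" "\<one> \<in> U \<inter> H"
    using UV by (auto simp: openin_subtopology_Int)
  let ?L = "K \<union> m_inv G ` K"
  have L: "compactin T ?L" using K(1) by (intro compactin_Un compactin_set_inv)
  \<comment> \<open>Conjugation as a map of two variables, so that the conjugates of
    \<open>V \<inter> H\<close> by all of \<open>?L\<close> form a single compact set and one index
    \<open>n\<close> serves them all.\<close>
  let ?f = "\<lambda>p. fst p \<otimes> snd p \<otimes> inv (fst p)"
  have "continuous_map (prod_topology T T) T ?f" by (intro group_continuous_intros)
  then have P: "compactin T (?f ` (?L \<times> (V \<inter> H)))"
    using L V by (intro image_compactin[of "prod_topology T T"]) (auto simp: compactin_Times)
  have "?f ` (?L \<times> (V \<inter> H)) \<subseteq> H"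
    using Kc by (auto intro!: H.inv_op_closed2 simp: subset_iff)
  from compactin_limit_subset_FC_iter_mult[OF P this U]
  obtain n where "?f ` (?L \<times> (V \<inter> H)) \<subseteq> B n <#> (U \<inter> H)" by blast
  \<comment> \<open>The open set gave the cover; enlarging it to the compact one puts the same set
    on both sides, as invariance under conjugation requires.\<close>
  also have "\<dots> \<subseteq> B n <#> (V \<inter> H)" using UV(4) by (auto simp: set_mult_def)
  finally have n: "k \<otimes> s \<otimes> inv k \<in> B n <#> (V \<inter> H)" if "k \<in> ?L" "s \<in> V \<inter> H" for k s
    using that by force
  interpret N: normal "B n" G by (rule FC_iter_normal)
  have "V \<inter> H \<subseteq> B (Suc n)"
  proof
    fix x assume x: "x \<in> V \<inter> H"
    then have "x \<in> B n <#> (V \<inter> H)" using Vc by (force simp: set_mult_def intro: bexI[of _ \<one>])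
    then have "conjugates G x \<subseteq> B n <#> (V \<inter> H)"
      using n by (intro FC_iter_mult_conj_closed[OF Kc K(2) Vc])
    \<comment> \<open>The compact set \<open>V \<inter> H\<close> is the witness, and passing
      through \<open>FC_modulo\<close> costs one stage, hence \<open>Suc n\<close>.\<close>
    then have "x \<in> FC_modulo G T (B n)" using x V Vc by (auto simp: FC_modulo_def)
    then show "x \<in> B (Suc n)" using FC_modulo_subset_FC_iter by blast
  qed
  then have sub: "U \<inter> H \<subseteq> B (Suc n)" using UV(4) by auto
  have "openin (subtopology T H) (B m)" if "m \<ge> Suc n" for m
  proof -
    interpret M: normal "B m" G by (rule FC_iter_normal)
    have "U \<inter> H \<subseteq> B m" using sub incseqD[OF incseq_FC_iter that] by auto
    \<comment> \<open>A subgroup containing a neighbourhood of the identity is a union of translates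
      of that neighbourhood.\<close>
    then have "B m <#> (U \<inter> H) = B m"
      using U(2) M.subset by (force simp: set_mult_def)
    then show ?thesis
      using openin_set_mult_subgroup[OF H.subgroup_axioms FC_iter_subset_limit[of m] U(1)] by simp
  qed
  then show ?thesis by blast
qed

text \<open>Once \<open>B n\<close> is open in the limit stage it can itself play the neighbourhood
  of the identity: \<open>P\<close> lies in some \<open>B m <#> B n\<close>, hence in the stage with
  the larger index.\<close>

lemma compactin_limit_subset_FC_iter:
  assumes K: "compactin T K" "generate G K = carrier G" and P: "compactin T P" "P \<subseteq> H"
  shows "\<exists>n. P \<subseteq> B n"
proof -
  obtain n where n: "openin (subtopology T H) (B n)"
    using FC_iter_open_in_limit[OF K] by blast
  have "\<one> \<in> B n" using FC_iter_normal normal_imp_subgroup subgroup.one_closed by blast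
  from compactin_limit_subset_FC_iter_mult[OF P n this]
  obtain m where m: "P \<subseteq> B m <#> B n" by blast
  interpret M: normal "B (max m n)" G by (rule FC_iter_normal)
  have "B m <#> B n \<subseteq> B (max m n)"
    using incseqD[OF incseq_FC_iter, of m "max m n"] incseqD[OF incseq_FC_iter, of n "max m n"]
    by (auto simp: set_mult_def)
  then show ?thesis using m by blast
qed

text \<open>For a class contained in \<open>H <#> C\<close>, the elements of \<open>H\<close> needed
  to express invariance under the generators lie in a compact set, hence in a single
  \<open>B m\<close>. The class is then already contained in \<open>B m <#> C\<close>.\<close>

lemma FC_modulo_limit:
  assumes K: "compactin T K" "generate G K = carrier G"
  shows "FC_modulo G T H = H"
proof
  show "H \<subseteq> FC_modulo G T H" using FC_limit_normal by (rule subset_FC_modulo)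
  show "FC_modulo G T H \<subseteq> H"
  proof
    note Kc = compactin_carrier[OF K(1)]
    interpret H: normal H G by (rule FC_limit_normal)
    fix x assume "x \<in> FC_modulo G T H"
    then obtain C where C: "x \<in> carrier G" "compactin T C" "conjugates G x \<subseteq> H <#> C"
      by (auto simp: FC_modulo_def)
    note Cc = compactin_carrier[OF C(2)]
    let ?L = "K \<union> m_inv G ` K"
    have L: "compactin T ?L" using K(1) by (intro compactin_Un compactin_set_inv)
    note Lc = compactin_carrier[OF L]
    \<comment> \<open>The elements of \<open>C\<close> that represent a conjugate of
      \<open>x\<close> modulo \<open>H\<close>. Unlike \<open>C\<close>, this set is carried into
      itself modulo \<open>H\<close> by every conjugation.\<close>
    let ?R = "{c \<in> C. \<exists>h\<in>H. h \<otimes> c \<in> conjugates G x}"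
    have Rc: "?R \<subseteq> carrier G" using Cc by auto
    have "\<one> \<otimes> x \<otimes> inv \<one> \<in> conjugates G x" unfolding conjugates_def by blast
    then have xx: "x \<in> conjugates G x" using C(1) by simp
    then obtain a c where ac: "x = a \<otimes> c" "a \<in> H" "c \<in> C" using C(3) by (auto simp: set_mult_def)
    \<comment> \<open>Contains every correction term
      \<open>k \<otimes> r \<otimes> inv k \<otimes> inv c'\<close> lying in \<open>H\<close>. It is
      built from \<open>C\<close> and not from \<open>?R\<close>, which is not known to be
      compact.\<close>
    let ?P = "(?L <#> (C <#> (m_inv G ` ?L <#> m_inv G ` C))) \<inter> H"
    have "compactin T ?P"
      by (intro compact_Int_closedin compactin_set_mult compactin_set_inv L C(2) closedin_closure_of)
    moreover have "compactin T {a}" using ac(2) by (simp add: topspace_carrier)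
    \<comment> \<open>The point \<open>a\<close> is included so that
      \<open>x = a \<otimes> c\<close> itself lies in \<open>B m <#> ?R\<close>.\<close>
    ultimately have "compactin T ({a} \<union> ?P)" by (rule compactin_Un[rotated])
    moreover have "{a} \<union> ?P \<subseteq> H" using ac(2) by blast
    ultimately obtain m where m: "a \<in> B m" "?P \<subseteq> B m"
      using compactin_limit_subset_FC_iter[OF K] by blast
    have conj: "k \<otimes> r \<otimes> inv k \<in> B m <#> ?R" if k: "k \<in> ?L" and r: "r \<in> ?R" for k r
    proof -
      obtain h where h: "h \<in> H" "h \<otimes> r \<in> conjugates G x" using r by blast
      obtain g where g: "g \<in> carrier G" "h \<otimes> r = g \<otimes> x \<otimes> inv g"
        using h(2) by (auto simp: conjugates_def)
      have kc: "k \<in> carrier G" using k Lc by blast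
      have rc: "r \<in> carrier G" "r \<in> C" "h \<in> carrier G" using r h Cc H.subset by blast+
      have "k \<otimes> (h \<otimes> r) \<otimes> inv k = (k \<otimes> g) \<otimes> x \<otimes> inv (k \<otimes> g)"
        unfolding g(2) using kc g(1) C(1) by (simp add: m_assoc inv_mult_group)
      moreover have "(k \<otimes> g) \<otimes> x \<otimes> inv (k \<otimes> g) \<in> conjugates G x"
        using kc g(1) unfolding conjugates_def by blast
      ultimately have "k \<otimes> (h \<otimes> r) \<otimes> inv k \<in> conjugates G x" by simp
      moreover from this obtain h' c' where c': "k \<otimes> (h \<otimes> r) \<otimes> inv k = h' \<otimes> c'" "h' \<in> H" "c' \<in> C"
        using C(3) by (auto simp: set_mult_def)
      ultimately have c'R: "c' \<in> ?R" by auto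
      have cc: "h' \<in> carrier G" "c' \<in> carrier G" using c' Cc H.subset by blast+
      let ?p = "k \<otimes> (r \<otimes> (inv k \<otimes> inv c'))"
      have cancel: "inv a \<otimes> (a \<otimes> b) = b" if "a \<in> carrier G" "b \<in> carrier G" for a b
        using that by (simp add: m_assoc[symmetric])
      \<comment> \<open>Inserting \<open>h\<close> turns \<open>r\<close> into a conjugate of
        \<open>x\<close>, whose conjugate by \<open>k\<close> is \<open>h' \<otimes> c'\<close>.
        What remains of \<open>?p\<close> is a product of a conjugate of \<open>inv h\<close> with
        \<open>h'\<close>, so it lies in \<open>H\<close>.\<close>
      have "?p = (k \<otimes> inv h \<otimes> inv k) \<otimes> ((k \<otimes> (h \<otimes> r) \<otimes> inv k) \<otimes> inv c')"
        using kc rc cc cancel by (simp add: m_assoc)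
      also have "\<dots> = (k \<otimes> inv h \<otimes> inv k) \<otimes> h'"
        unfolding c'(1) using kc rc cc by (simp add: m_assoc)
      also have "\<dots> \<in> H"
        using h(1) kc c'(2) by (intro H.m_closed H.inv_op_closed2 H.m_inv_closed)
      finally have "?p \<in> H" .
      moreover have "?p \<in> ?L <#> (C <#> (m_inv G ` ?L <#> m_inv G ` C))"
        by (intro set_mult_memI imageI k rc(2) c'(3))
      ultimately have "?p \<in> B m" using m(2) by blast
      moreover have "k \<otimes> r \<otimes> inv k = ?p \<otimes> c'" using kc rc cc by (simp add: m_assoc)
      ultimately show ?thesis using set_mult_memI[OF _ c'R] by simp
    qed
    have "c \<in> ?R" using ac xx by auto
    then have "x \<in> B m <#> ?R" unfolding ac(1) by (rule set_mult_memI[OF m(1)])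
    then have "conjugates G x \<subseteq> B m <#> ?R"
      using conj by (intro FC_iter_mult_conj_closed[OF Kc K(2) Rc])
    \<comment> \<open>Invariance needed \<open>?R\<close>; the witness must be compact, so
      \<open>C\<close> returns.\<close>
    also have "\<dots> \<subseteq> B m <#> C" by (auto simp: set_mult_def)
    finally have "x \<in> FC_modulo G T (B m)" using C by (auto simp: FC_modulo_def)
    then show "x \<in> H"
      using FC_modulo_subset_FC_iter FC_iter_subset_limit by blast
  qed
qed

section \<open>Stationary stages\<close>

lemma FC_step_limit:
  assumes "compactin T K" "generate G K = carrier G"
  shows "FC_step G T H = H"
  using FC_step_eq_closure[OF FC_limit_normal] FC_modulo_limit[OF assms] by simp

text \<open>When the limit stage is the whole group, the compact generating set lies in one finite
  stage, and that stage is a subgroup.\<close>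

lemma FC_iter_eq_carrier:
  assumes K: "compactin T K" "generate G K = carrier G" and "H = carrier G"
  shows "\<exists>n. B n = carrier G"
proof -
  obtain n where "K \<subseteq> B n"
    using compactin_limit_subset_FC_iter[OF K K(1)] compactin_carrier[OF K(1)] assms(3) by auto
  then have "generate G K \<subseteq> B n"
    by (intro generate_subgroup_incl normal_imp_subgroup FC_iter_normal)
  then have "B n = carrier G" using K(2) FC_iter_carrier by (intro equalityI) simp_all
  then show ?thesis ..
qed

text \<open>Needed to conclude that the series stops at a finite stage equal to the whole
  group.\<close>

lemma FC_step_carrier: "FC_step G T (carrier G) = carrier G"
proof -
  have "carrier G \<lhd> G" by (simp add: normal_inv_iff subgroup_self)
  moreover have "closedin T (carrier G)" by (metis closedin_topspace topspace_carrier)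
  ultimately have "FC_step G T (carrier G) = T closure_of FC_modulo G T (carrier G)"
    and "carrier G \<subseteq> FC_modulo G T (carrier G)"
    by (simp_all add: FC_step_eq_closure subset_FC_modulo)
  moreover have "FC_modulo G T (carrier G) \<subseteq> carrier G" by (auto simp: FC_modulo_def)
  ultimately show ?thesis by (metis antisym closure_of_topspace topspace_carrier)
qed

end

section \<open>Finite ordinals\<close>

text \<open>The starting value \<open>LEAST \<alpha>. True\<close> is the ordinal zero.\<close>

definition ordinal_of_nat :: "nat \<Rightarrow> 'a ordinal" where
  "ordinal_of_nat n = (ordsucc ^^ n) (LEAST \<alpha>. True)"

lemma ordinal_of_nat_Suc [simp]: "ordinal_of_nat (Suc n) = ordsucc (ordinal_of_nat n)"
  by (simp add: ordinal_of_nat_def)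

lemma lessThan_ordinal_of_nat_0: "{..<ordinal_of_nat 0 :: 'a ordinal} = {}"
  by (auto simp: ordinal_of_nat_def dest: not_less_Least)

lemma finite_ordinal_of_nat: "finite_ordinal (ordinal_of_nat n :: 'a ordinal)"
  unfolding finite_ordinal_def
proof (induction n)
  case 0
  then show ?case by (simp add: lessThan_ordinal_of_nat_0)
next
  case (Suc n)
  then show ?case
    by (simp add: lessThan_ordsucc lessThan_Suc_atMost ivl_disj_un_singleton(2)[symmetric])
qed

lemma finite_ordinal_mono: "finite_ordinal \<beta> \<Longrightarrow> \<alpha> \<le> \<beta> \<Longrightarrow> finite_ordinal \<alpha>"
  unfolding finite_ordinal_def by (erule finite_subset[rotated]) auto

text \<open>A nonzero finite ordinal is the successor of the maximum of its predecessors, to which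
  the induction hypothesis applies.\<close>

lemma finite_ordinal_imp_of_nat:
  assumes "finite_ordinal (\<alpha> :: 'a ordinal)"
  shows "\<alpha> \<in> range ordinal_of_nat"
  using assms
proof (induction \<alpha> rule: less_induct)
  case (less \<alpha>)
  have fin: "finite {..<\<alpha>}" using less.prems by (simp add: finite_ordinal_def)
  show ?case
  proof (cases "{..<\<alpha>} = {}")
    case True
    have "\<alpha> = ordinal_of_nat 0"
    proof (rule antisym)
      show "\<alpha> \<le> ordinal_of_nat 0" using True by (metis lessThan_iff empty_iff not_less)
      show "ordinal_of_nat 0 \<le> \<alpha>" by (simp add: ordinal_of_nat_def Least_le)
    qed
    then show ?thesis by blast
  next
    case False
    let ?\<beta> = "Max {..<\<alpha>}"
    have \<beta>: "?\<beta> < \<alpha>" using Max_in[OF fin False] by simp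
    have "ordsucc ?\<beta> = \<alpha>"
      unfolding ordsucc_def
    proof (rule Least_equality)
      show "\<alpha> \<le> \<gamma>" if "?\<beta> < \<gamma>" for \<gamma>
        using that Max_ge[OF fin, of \<gamma>] by (meson lessThan_iff not_less)
    qed (rule \<beta>)
    moreover have "?\<beta> \<in> range ordinal_of_nat"
      using \<beta> finite_ordinal_mono[OF less.prems] by (intro less.IH) auto
    ultimately show ?thesis by (metis ordinal_of_nat_Suc rangeE rangeI)
  qed
qed

lemma not_finite_omega0: "\<not> finite_ordinal (omega0 :: 'a ordinal)"
  unfolding omega0_def by (rule LeastI_ex) (rule infinite_ordinal_exists)

lemma less_omega0_iff: "(\<alpha> :: 'a ordinal) < omega0 \<longleftrightarrow> finite_ordinal \<alpha>"
  using not_less_Least[of \<alpha> "\<lambda>\<alpha>. \<not> finite_ordinal \<alpha>"] not_finite_omega0 finite_ordinal_mono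
  by (metis not_less omega0_def)

lemma lessThan_omega0: "{..<omega0 :: 'a ordinal} = range ordinal_of_nat"
  using finite_ordinal_imp_of_nat by (auto simp: less_omega0_iff finite_ordinal_of_nat)

section \<open>The series at finite ordinals and at \<open>omega0\<close>\<close>

lemma FC_series_ordinal_of_nat:
  fixes T :: "'a topology"
  shows "FC_series G T (ordinal_of_nat n :: 'a ordinal) = FC_iter G T n"
  by (induction n) (simp_all add: FC_series_zero lessThan_ordinal_of_nat_0 FC_series_ordsucc)

text \<open>The limit clause applies because the successor of a finite ordinal is finite, and the
  ordinals below \<open>omega0\<close> are exactly the values of
  \<open>ordinal_of_nat\<close>.\<close>

lemma FC_series_omega0:
  fixes T :: "'a topology"
  shows "FC_series G T (omega0 :: 'a ordinal) = T closure_of (\<Union>n. FC_iter G T n)"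
proof -
  have "FC_series G T (omega0 :: 'a ordinal) =
      T closure_of (\<Union>\<beta>\<in>{..<omega0 :: 'a ordinal}. FC_series G T \<beta>)"
  proof (rule FC_series_limit)
    show "{..<omega0 :: 'a ordinal} \<noteq> {}" by (simp add: lessThan_omega0)
    fix \<beta> :: "'a ordinal" assume "\<beta> < omega0"
    then obtain n where "\<beta> = ordinal_of_nat n" using lessThan_omega0 by blast
    then have "ordsucc \<beta> < omega0"
      using finite_ordinal_of_nat[of "Suc n"] by (simp add: less_omega0_iff)
    then show "\<exists>\<gamma><omega0. \<beta> < \<gamma>" using less_ordsucc by blast
  qed
  then show ?thesis by (simp add: lessThan_omega0 FC_series_ordinal_of_nat)
qed

theorem theorem1p12:
  fixes G :: "('a, 'b) monoid_scheme" and T :: "'a topology"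
  assumes "locally_compact_group G T"
    and "compactly_generated G T"
  shows "FC_class G T \<le> omega0 \<and>
         (FC_hypercentral G T \<longrightarrow> finite_ordinal (FC_class G T))"
proof -
  interpret locally_compact_group G T by (rule assms(1))
  obtain K where K: "compactin T K" "generate G K = carrier G"
    using assms(2) unfolding compactly_generated_def by blast
  have le: "FC_class G T \<le> omega0"
    unfolding FC_class_def
    by (rule Least_le) (simp only: FC_series_ordsucc FC_series_omega0 FC_step_limit[OF K])
  have "finite_ordinal (FC_class G T)" if hc: "FC_hypercentral G T"
  proof (rule ccontr)
    assume inf: "\<not> finite_ordinal (FC_class G T)"
    \<comment> \<open>Only \<open>omega0\<close> is left as an infinite value under the bound, so
      hypercentrality says that the limit stage is the whole group.\<close>
    then have "FC_class G T = omega0" using le less_omega0_iff by (metis order.order_iff_strict)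
    then have "T closure_of (\<Union>n. FC_iter G T n) = carrier G"
      using hc by (simp add: FC_hypercentral_def FC_hypercentre_def FC_series_omega0)
    then obtain n where "FC_iter G T n = carrier G" using FC_iter_eq_carrier[OF K] by blast
    \<comment> \<open>The series is stationary at \<open>n\<close>, so the least stationary index is
      finite, against the assumption.\<close>
    then have "FC_class G T \<le> ordinal_of_nat n"
      unfolding FC_class_def
      by (intro Least_le) (simp add: FC_series_ordsucc FC_series_ordinal_of_nat FC_step_carrier)
    then show False using inf finite_ordinal_of_nat finite_ordinal_mono by blast
  qed
  then show ?thesis using le by blast
qed

end
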